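(* Let $\Omega\subset\mathbb{C}^n$ be open, $z\in\Omega$, $\varphi$ plurisubharmonic in $\Omega$ and $\psi$ plurisubharmonic in $\mathbb{C}^n$. Let $T_\psi$ be the set of $t\ge0$ such that $e^{-2(1+\tau)t\psi}\in L^1_{Loc}(0)$ for some $\tau>0$ (an interval containing $0$). (1) On $T_\psi$, the function $t\mapsto \dfrac{1}{\nu_{z,t\psi}(\varphi)}$ is concave and the function $t\mapsto\nu_{z,t\psi}(\varphi)$ is convex. (2) If $[0,n)\subset T_\psi$ and $e^{-2n\psi}\notin L^1_{Loc}(0)$, then the function $t\mapsto (n-t)\,\nu_{z,t\psi}(\varphi)$ is decreasing on $[0,n)$. (3) For $0\le t\le n-1$, $$\nu_{z,0}(\varphi)\le\nu_{z,n-1}(\varphi)\le(n-t)\,\nu_{z,t}(\varphi)\le n\,\nu_{z,0}(\varphi).$$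
   Context: Plurisubharmonic functions are not identically $-\infty$ on any connected component of their domain. $L^1_{Loc}(a)$ denotes the functions integrable (Lebesgue measure) on some neighbourhood of $a$. The generalized Lelong number of $\varphi$ at $a\in\Omega$ with respect to a plurisubharmonic function $\psi$ on $\mathbb{C}^n$ satisfying $e^{-2(1+\tau)\psi}\in L^1_{Loc}(0)$ for some $\tau>0$ is $$\nu_{a,\psi}(\varphi)=\inf\{s>0:\ \zeta\mapsto e^{-\frac{2\varphi(\zeta)}{s}-2\psi(\zeta-a)}\in L^1_{Loc}(a)\}.$$ In particular $\nu_{z,t\psi}(\varphi)$ is this number with weight $t\psi$. For a real number $t\in[0,n)$, $\nu_{a,t}(\varphi)$ denotes the number obtained with the weight $t\log|\cdot|$, i.e. $$\nu_{a,t}(\varphi)=\inf\{s>0:\ \zeta\mapsto e^{-\frac{2\varphi(\zeta)}{s}-2t\log|\zeta-a|}\in L^1_{Loc}(a)\}.$$ "Decreasing" means non-increasing, and $1/0=+\infty$. *)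

theory Defs
  imports "HOL-Analysis.Analysis"
begin

text \<open>
  Complex \<open>n\<close>-space is \<open>complex ^ 'n\<close> with \<open>n = CARD('n)\<close>; its \<open>norm\<close> is the Hermitian norm and
  its \<open>lebesgue\<close> measure is the \<open>2n\<close>-dimensional Lebesgue measure.  A function on an open set
  \<open>\<Omega>\<close> is a total function whose values outside \<open>\<Omega>\<close> are irrelevant.
\<close>

subsection \<open>Plurisubharmonic functions\<close>

definition usc_on :: "'a::topological_space set \<Rightarrow> ('a \<Rightarrow> ereal) \<Rightarrow> bool" where
  "usc_on S u \<longleftrightarrow> (\<forall>c. openin (top_of_set S) {x \<in> S. u x < c})"

text \<open>Integral with values in the extended reals; it is meaningful as soon as one of the two parts
  is finite.  Below the positive part is always finite, the integrand being bounded above.\<close>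

definition ereal_integral :: "'a measure \<Rightarrow> ('a \<Rightarrow> ereal) \<Rightarrow> ereal" where
  "ereal_integral M f =
     enn2ereal (\<integral>\<^sup>+ x. e2ennreal (f x) \<partial>M) - enn2ereal (\<integral>\<^sup>+ x. e2ennreal (- f x) \<partial>M)"

text \<open>Subharmonic functions of one complex variable; the constant \<open>-\<infinity>\<close> is allowed here.\<close>

definition subharmonic_on :: "complex set \<Rightarrow> (complex \<Rightarrow> ereal) \<Rightarrow> bool" where
  "subharmonic_on D u \<longleftrightarrow>
     open D \<and> usc_on D u \<and> (\<forall>w\<in>D. u w < \<infinity>) \<and>
     (\<forall>c r. 0 < r \<and> cball c r \<subseteq> D \<longrightarrow>
        u c \<le> ereal_integral (lebesgue_on {0..2 * pi}) (\<lambda>\<theta>. u (c + of_real r * cis \<theta>)) / ereal (2 * pi))"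

definition plurisubharmonic_on :: "(complex ^ 'n) set \<Rightarrow> (complex ^ 'n \<Rightarrow> ereal) \<Rightarrow> bool" where
  "plurisubharmonic_on \<Omega> u \<longleftrightarrow>
     open \<Omega> \<and> usc_on \<Omega> u \<and> (\<forall>x\<in>\<Omega>. u x < \<infinity>) \<and>
     (\<forall>a b. subharmonic_on {w. a + w *s b \<in> \<Omega>} (\<lambda>w. u (a + w *s b))) \<and>
     (\<forall>C\<in>components \<Omega>. \<exists>x\<in>C. u x \<noteq> -\<infinity>)"

subsection \<open>Generalized Lelong numbers\<close>

definition ereal_exp :: "ereal \<Rightarrow> ennreal" where
  "ereal_exp x = (case x of ereal r \<Rightarrow> ennreal (exp r) | PInfty \<Rightarrow> \<infinity> | MInfty \<Rightarrow> 0)"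

text \<open>Nonnegative functions integrable on some neighbourhood of \<open>a\<close>.  The neighbourhood may be
  shrunk, so for a function defined on an open set containing \<open>a\<close> it may be taken inside that set.\<close>

definition L1_loc :: "'a::euclidean_space \<Rightarrow> ('a \<Rightarrow> ennreal) set" where
  "L1_loc a = {f. \<exists>U. open U \<and> a \<in> U \<and> f \<in> borel_measurable (lebesgue_on U) \<and>
                      (\<integral>\<^sup>+ x. f x \<partial>lebesgue_on U) < \<infinity>}"

definition admissible_weight :: "(complex ^ 'n \<Rightarrow> ereal) \<Rightarrow> bool" where
  "admissible_weight \<psi> \<longleftrightarrow>
     (\<exists>\<tau>>0. (\<lambda>\<zeta>. ereal_exp (- (ereal (2 * (1 + \<tau>)) * \<psi> \<zeta>))) \<in> L1_loc 0)"

text \<open>In the exponent neither summand is \<open>-\<infinity>\<close> when \<open>\<phi>\<close> and \<open>\<psi>\<close> are plurisubharmonic, so the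
  sum is unambiguous.  As \<open>Inf {} = \<infinity>\<close>, the number is \<open>\<infinity>\<close> if no \<open>s\<close> qualifies.\<close>

definition lelong_number ::
    "complex ^ 'n \<Rightarrow> (complex ^ 'n \<Rightarrow> ereal) \<Rightarrow> (complex ^ 'n \<Rightarrow> ereal) \<Rightarrow> ereal" where
  "lelong_number a \<psi> \<phi> =
     Inf {ereal s | s. 0 < s \<and>
        (\<lambda>\<zeta>. ereal_exp (- (2 * \<phi> \<zeta> / ereal s) - 2 * \<psi> (\<zeta> - a))) \<in> L1_loc a}"

text \<open>The weight \<open>t \<psi>\<close>; for \<open>t = 0\<close> it is the zero function, since \<open>0 * (-\<infinity>) = 0\<close> in \<open>ereal\<close>.\<close>

definition scale_weight :: "real \<Rightarrow> (complex ^ 'n \<Rightarrow> ereal) \<Rightarrow> complex ^ 'n \<Rightarrow> ereal" where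
  "scale_weight t \<psi> = (\<lambda>\<zeta>. ereal t * \<psi> \<zeta>)"

definition log_norm :: "complex ^ 'n \<Rightarrow> ereal" where
  "log_norm \<zeta> = (if \<zeta> = 0 then -\<infinity> else ereal (ln (norm \<zeta>)))"

definition lelong_number_log :: "complex ^ 'n \<Rightarrow> real \<Rightarrow> (complex ^ 'n \<Rightarrow> ereal) \<Rightarrow> ereal" where
  "lelong_number_log a t \<phi> = lelong_number a (scale_weight t log_norm) \<phi>"

definition weight_set :: "(complex ^ 'n \<Rightarrow> ereal) \<Rightarrow> real set" where
  "weight_set \<psi> = {t. 0 \<le> t \<and> admissible_weight (scale_weight t \<psi>)}"

subsection \<open>Convexity for functions with values in \<open>[0, \<infinity>]\<close>\<close>

text \<open>The library's \<open>convex_on\<close> and \<open>concave_on\<close> are restricted to real-valued functions.\<close>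

definition ereal_convex_on :: "'a::real_vector set \<Rightarrow> ('a \<Rightarrow> ereal) \<Rightarrow> bool" where
  "ereal_convex_on S f \<longleftrightarrow> convex S \<and>
     (\<forall>x\<in>S. \<forall>y\<in>S. \<forall>u\<ge>0. \<forall>v\<ge>0. u + v = 1 \<longrightarrow>
        f (u *\<^sub>R x + v *\<^sub>R y) \<le> ereal u * f x + ereal v * f y)"

definition ereal_concave_on :: "'a::real_vector set \<Rightarrow> ('a \<Rightarrow> ereal) \<Rightarrow> bool" where
  "ereal_concave_on S f \<longleftrightarrow> convex S \<and>
     (\<forall>x\<in>S. \<forall>y\<in>S. \<forall>u\<ge>0. \<forall>v\<ge>0. u + v = 1 \<longrightarrow>
        ereal u * f x + ereal v * f y \<le> f (u *\<^sub>R x + v *\<^sub>R y))"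

end

theory Submission
  imports Defs
begin

text \<open>
  All assertions are read off from one convex set.  For weights \<open>\<phi>\<close> and \<open>\<rho>\<close> consider the set \<open>K\<close> of
  pairs \<open>(c, t)\<close> of nonnegative numbers such that \<open>e\<^sup>-\<^sup>2\<^sup>c\<^sup>\<phi>\<^sup>-\<^sup>2\<^sup>t\<^sup>\<rho>\<close> is integrable near \<open>z\<close>.  The
  exponent is affine in \<open>(c, t)\<close>, so at a convex combination of two pairs the integrand is at most the
  maximum, hence the sum, of the two integrands; therefore \<open>K\<close> is convex
  (\<open>convex_integrable_exponents\<close>).

  Take \<open>\<rho>(x) = \<psi>(x - z)\<close>.  For \<open>t\<close> in \<open>T\<^sub>\<psi>\<close> the pair \<open>(0, t)\<close> lies in \<open>K\<close>, and \<open>1 / \<nu>\<^sub>t\<close> is the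
  supremum of the slice \<open>{c. (c, t) \<in> K}\<close> (\<open>inverse_lelong_number\<close>).  Suprema of slices of a convex
  set form a concave function.  Convexity of \<open>\<nu>\<close> follows because the harmonic mean is at most the
  arithmetic mean.

  For the monotonicity of \<open>(N - t) \<nu>\<^sub>t\<close> let \<open>t < t' < m < N\<close>.  The segment from a point \<open>(1 / s, t)\<close>
  of \<open>K\<close> to \<open>(0, m)\<close> meets the slice over \<open>t'\<close> and yields \<open>\<nu>\<^sub>t\<^sub>' \<le> s (m - t) / (m - t')\<close>; then
  \<open>m\<close> tends to \<open>N\<close> (\<open>lelong_number_antimono\<close>).

  The logarithmic weight has \<open>[0, n) \<subseteq> T\<close>, because \<open>|x|\<^sup>-\<^sup>2\<^sup>p\<close> is integrable near the origin of a real
  space of dimension \<open>2n\<close> for \<open>p < n\<close>.  The last two inequalities of the chain are then the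
  monotonicity for \<open>0 \<le> t \<le> n - 1\<close>, and the first one holds because the logarithm is negative
  near \<open>0\<close>.  Plurisubharmonic functions enter as semicontinuous, hence measurable, weights with
  values below \<open>\<infinity>\<close>.
\<close>

section \<open>Measurability and local integrability\<close>

lemma ereal_exp_mono: "x \<le> y \<Longrightarrow> ereal_exp x \<le> ereal_exp y"
  by (cases x; cases y) (auto simp: ereal_exp_def intro: ennreal_leI)

lemma ereal_exp_measurable [measurable]: "ereal_exp \<in> borel_measurable borel"
proof -
  have *: "ereal_exp = (\<lambda>x. if x = \<infinity> then \<infinity> else if x = -\<infinity> then 0 else ennreal (exp (real_of_ereal x)))"
    by (rule ext, case_tac x) (auto simp: ereal_exp_def)
  show ?thesis by (subst *) measurable
qed

lemma usc_on_borel_measurable: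
  assumes "open S" "usc_on S u"
  shows "u \<in> borel_measurable (restrict_space borel S)"
proof (rule borel_measurableI_less)
  fix y
  have "openin (top_of_set S) {x \<in> S. u x < y}" using assms by (simp add: usc_on_def)
  then have "open {x \<in> S. u x < y}" using assms(1) openin_open_trans by blast
  then show "{x \<in> space (restrict_space borel S). u x < y} \<in> sets (restrict_space borel S)"
    by (auto simp: sets_restrict_space_iff space_restrict_space assms(1))
qed

lemma borel_measurable_restrict_lebesgue_on:
  fixes f :: "'a::euclidean_space \<Rightarrow> 'b::topological_space"
  assumes "f \<in> borel_measurable (restrict_space borel S)"
  shows "f \<in> borel_measurable (lebesgue_on S)"
proof -
  have "id \<in> lebesgue_on S \<rightarrow>\<^sub>M restrict_space borel S"
    by (rule measurable_restrict_space3) auto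
  from measurable_comp[OF this assms] show ?thesis by simp
qed

lemma borel_measurable_lebesgue_on:
  fixes f :: "'a::euclidean_space \<Rightarrow> 'b::topological_space"
  assumes "f \<in> borel_measurable borel"
  shows "f \<in> borel_measurable (lebesgue_on S)"
  using assms by (intro borel_measurable_restrict_lebesgue_on measurable_restrict_space1)

lemma L1_loc_dominated:
  assumes f: "f \<in> L1_loc a" and g: "g \<in> L1_loc a"
    and V: "open V" "a \<in> V" and h: "h \<in> borel_measurable (lebesgue_on V)"
    and le: "\<And>x. x \<in> V \<Longrightarrow> h x \<le> f x + g x"
  shows "h \<in> L1_loc a"
proof -
  obtain U where U: "open U" "a \<in> U" "f \<in> borel_measurable (lebesgue_on U)"
      "(\<integral>\<^sup>+ x. f x \<partial>lebesgue_on U) < \<infinity>"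
    using f by (auto simp: L1_loc_def)
  obtain U' where U': "open U'" "a \<in> U'" "g \<in> borel_measurable (lebesgue_on U')"
      "(\<integral>\<^sup>+ x. g x \<partial>lebesgue_on U') < \<infinity>"
    using g by (auto simp: L1_loc_def)
  define W where "W = U \<inter> U' \<inter> V"
  have W: "open W" "a \<in> W" "W \<subseteq> U" "W \<subseteq> U'" "W \<subseteq> V" using U U' V by (auto simp: W_def)
  have fm: "f \<in> borel_measurable (lebesgue_on W)" "g \<in> borel_measurable (lebesgue_on W)"
    "h \<in> borel_measurable (lebesgue_on W)"
    using U(3) U'(3) h W by (auto intro: measurable_restrict_mono)
  have shrink: "(\<integral>\<^sup>+ x. k x \<partial>lebesgue_on W) \<le> (\<integral>\<^sup>+ x. k x \<partial>lebesgue_on X)"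
    if "open X" "W \<subseteq> X" for k :: "'a \<Rightarrow> ennreal" and X
    using that W(1) by (subst (1 2) nn_integral_restrict_space)
      (auto intro!: nn_integral_mono split: split_indicator)
  have "(\<integral>\<^sup>+ x. h x \<partial>lebesgue_on W) \<le> (\<integral>\<^sup>+ x. f x + g x \<partial>lebesgue_on W)"
    using W by (intro nn_integral_mono le) (auto simp: space_restrict_space)
  also have "\<dots> = (\<integral>\<^sup>+ x. f x \<partial>lebesgue_on W) + (\<integral>\<^sup>+ x. g x \<partial>lebesgue_on W)"
    by (rule nn_integral_add[OF fm(1,2)])
  also have "\<dots> \<le> (\<integral>\<^sup>+ x. f x \<partial>lebesgue_on U) + (\<integral>\<^sup>+ x. g x \<partial>lebesgue_on U')"
    using W U(1) U'(1) by (intro add_mono shrink)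
  also have "\<dots> < \<infinity>" using U(4) U'(4) by simp
  finally show ?thesis using W fm by (auto simp: L1_loc_def)
qed

lemma L1_loc_const:
  fixes a :: "'a::euclidean_space"
  assumes "c < \<infinity>" shows "(\<lambda>_. c) \<in> L1_loc a"
proof -
  have "(\<integral>\<^sup>+ x. c \<partial>lebesgue_on (ball a 1)) = c * emeasure lborel (ball a 1)"
    by (simp add: emeasure_restrict_space)
  also have "\<dots> < \<infinity>"
    using assms emeasure_bounded_finite[OF bounded_ball, of a 1] by (simp add: ennreal_mult_less_top)
  finally show ?thesis
    unfolding L1_loc_def by (auto intro!: exI[of _ "ball a 1"])
qed

lemma L1_loc_translate:
  fixes f :: "'a::euclidean_space \<Rightarrow> ennreal"
  assumes f: "f \<in> L1_loc 0" and [measurable]: "f \<in> borel_measurable borel"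
  shows "(\<lambda>x. f (x - a)) \<in> L1_loc a"
proof -
  obtain U where U: "open U" "0 \<in> U" "(\<integral>\<^sup>+ x. f x \<partial>lebesgue_on U) < \<infinity>"
    using f by (auto simp: L1_loc_def)
  define V where "V = (+) a ` U"
  have V: "open V" "a \<in> V" using U open_translation[OF U(1), of a] by (auto simp: V_def image_iff)
  have [measurable]: "U \<in> sets borel" "V \<in> sets borel" using U V by auto
  have "(\<integral>\<^sup>+ x. f (x - a) \<partial>lebesgue_on V) = (\<integral>\<^sup>+ x. f (x - a) * indicator V x \<partial>lborel)"
    using V by (simp add: nn_integral_restrict_space nn_integral_completion)
  also have "\<dots> = (\<integral>\<^sup>+ x. f (x - a) * indicator V x \<partial>distr lborel borel ((+) a))"
    by (simp add: lborel_distr_plus)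
  also have "\<dots> = (\<integral>\<^sup>+ x. f x * indicator V (a + x) \<partial>lborel)"
    by (subst nn_integral_distr) auto
  also have "\<dots> = (\<integral>\<^sup>+ x. f x * indicator U x \<partial>lborel)"
    by (intro nn_integral_cong) (auto simp: V_def split: split_indicator)
  also have "\<dots> = (\<integral>\<^sup>+ x. f x \<partial>lebesgue_on U)"
    using U by (simp add: nn_integral_restrict_space nn_integral_completion)
  finally have "(\<integral>\<^sup>+ x. f (x - a) \<partial>lebesgue_on V) < \<infinity>" using U(3) by simp
  moreover have "(\<lambda>x. f (x - a)) \<in> borel_measurable (lebesgue_on V)"
    by (rule borel_measurable_lebesgue_on) measurable
  ultimately show ?thesis using V by (auto simp: L1_loc_def)
qed

section \<open>The convex set of integrable pairs of exponents\<close>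

text \<open>The function \<open>e\<^sup>-\<^sup>2\<^sup>c\<^sup>\<phi>\<^sup>-\<^sup>2\<^sup>t\<^sup>\<rho>\<close>.  A vanishing coefficient removes its weight also
  where that weight is \<open>-\<infinity>\<close>, since \<open>0 * (-\<infinity>) = 0\<close> in \<open>ereal\<close>.\<close>

definition weighted_exp :: "('a \<Rightarrow> ereal) \<Rightarrow> ('a \<Rightarrow> ereal) \<Rightarrow> real \<Rightarrow> real \<Rightarrow> 'a \<Rightarrow> ennreal" where
  "weighted_exp \<phi> \<rho> c t = (\<lambda>x. ereal_exp (- (ereal (2 * c) * \<phi> x) - ereal (2 * t) * \<rho> x))"

text \<open>The set \<open>K\<close> of pairs of nonnegative exponents for which this function is integrable
  near \<open>a\<close>.\<close>

definition integrable_exponents ::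
    "'a::euclidean_space \<Rightarrow> ('a \<Rightarrow> ereal) \<Rightarrow> ('a \<Rightarrow> ereal) \<Rightarrow> (real \<times> real) set" where
  "integrable_exponents a \<phi> \<rho> = {(c, t). 0 \<le> c \<and> 0 \<le> t \<and> weighted_exp \<phi> \<rho> c t \<in> L1_loc a}"

text \<open>Where a weight is \<open>-\<infinity>\<close> the exponent is not affine: its coefficient may vanish at one of the
  two pairs only.  Then the exponent at the other pair is \<open>\<infinity>\<close>, so that the bound by the maximum
  survives.\<close>

lemma weighted_exponent_convex:
  fixes x y :: ereal
  assumes "x < \<infinity>" "y < \<infinity>" "0 \<le> c" "0 \<le> d" "0 \<le> s" "0 \<le> t" "0 \<le> u" "0 \<le> v" "u + v = 1"
  shows "- (ereal (2 * (u * c + v * d)) * x) - ereal (2 * (u * s + v * t)) * y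
    \<le> max (- (ereal (2 * c) * x) - ereal (2 * s) * y) (- (ereal (2 * d) * x) - ereal (2 * t) * y)"
    (is "?z \<le> max ?x ?y")
proof (cases "?x = \<infinity> \<or> ?y = \<infinity>")
  case True
  then show ?thesis by (auto simp: max_def)
next
  case False
  have real: "u * p + v * q \<le> max p q" for p q :: real
    using assms convex_bound_le[of p "max p q" q u v] by auto
  have x0: "c = 0 \<and> d = 0" if "x = -\<infinity>"
    using False assms that by (cases y) (auto split: if_splits)
  have y0: "s = 0 \<and> t = 0" if "y = -\<infinity>"
    using False assms that by (cases x) (auto split: if_splits)
  obtain p where p: "ereal (2 * c) * x = ereal (2 * c * p)" "ereal (2 * d) * x = ereal (2 * d * p)"
      "ereal (2 * (u * c + v * d)) * x = ereal (2 * (u * c + v * d) * p)"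
    using x0 assms(1) by (cases x) (auto simp: zero_ereal_def[symmetric])
  obtain q where q: "ereal (2 * s) * y = ereal (2 * s * q)" "ereal (2 * t) * y = ereal (2 * t * q)"
      "ereal (2 * (u * s + v * t)) * y = ereal (2 * (u * s + v * t) * q)"
    using y0 assms(2) by (cases y) (auto simp: zero_ereal_def[symmetric])
  show ?thesis
    unfolding p q using real[of "- (2 * c * p) - 2 * s * q" "- (2 * d * p) - 2 * t * q"]
    by (simp add: algebra_simps flip: ereal_max)
qed

lemma weighted_exp_convex:
  assumes "\<phi> x < \<infinity>" "\<rho> x < \<infinity>" "0 \<le> c" "0 \<le> d" "0 \<le> s" "0 \<le> t" "0 \<le> u" "0 \<le> v" "u + v = 1"
  shows "weighted_exp \<phi> \<rho> (u * c + v * d) (u * s + v * t) x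
    \<le> weighted_exp \<phi> \<rho> c s x + weighted_exp \<phi> \<rho> d t x"
proof -
  have *: "ereal_exp (max p q) \<le> ereal_exp p + ereal_exp q" for p q
    by (auto simp: max_def)
  show ?thesis
    unfolding weighted_exp_def
    by (rule order_trans[OF ereal_exp_mono[OF weighted_exponent_convex[OF assms]] *])
qed

lemma weighted_exp_measurable:
  assumes [measurable]: "\<phi> \<in> borel_measurable M" "\<rho> \<in> borel_measurable M"
  shows "weighted_exp \<phi> \<rho> c t \<in> borel_measurable M"
  unfolding weighted_exp_def by measurable

text \<open>What is needed of the weights: near \<open>a\<close> the function is Lebesgue measurable and does not
  take the value \<open>\<infinity>\<close>.\<close>

definition meas_below_top_near :: "'a::euclidean_space \<Rightarrow> ('a \<Rightarrow> ereal) \<Rightarrow> bool" where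
  "meas_below_top_near a f \<longleftrightarrow>
     (\<exists>V. open V \<and> a \<in> V \<and> f \<in> borel_measurable (lebesgue_on V) \<and> (\<forall>x\<in>V. f x < \<infinity>))"

lemma meas_below_top_near_common:
  assumes "meas_below_top_near a \<phi>" "meas_below_top_near a \<rho>"
  obtains V where "open V" "a \<in> V" "\<phi> \<in> borel_measurable (lebesgue_on V)"
    "\<rho> \<in> borel_measurable (lebesgue_on V)" "\<And>x. x \<in> V \<Longrightarrow> \<phi> x < \<infinity>" "\<And>x. x \<in> V \<Longrightarrow> \<rho> x < \<infinity>"
proof -
  obtain U where U: "open U" "a \<in> U" "\<phi> \<in> borel_measurable (lebesgue_on U)" "\<forall>x\<in>U. \<phi> x < \<infinity>"
    using assms(1) by (auto simp: meas_below_top_near_def)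
  obtain W where W: "open W" "a \<in> W" "\<rho> \<in> borel_measurable (lebesgue_on W)" "\<forall>x\<in>W. \<rho> x < \<infinity>"
    using assms(2) by (auto simp: meas_below_top_near_def)
  show thesis
    by (rule that[of "U \<inter> W"])
      (use U W in \<open>auto intro: measurable_restrict_mono[of _ _ U] measurable_restrict_mono[of _ _ W]\<close>)
qed

lemma convex_integrable_exponents:
  assumes "meas_below_top_near a \<phi>" "meas_below_top_near a \<rho>"
  shows "convex (integrable_exponents a \<phi> \<rho>)"
proof -
  obtain V where V: "open V" "a \<in> V" "\<phi> \<in> borel_measurable (lebesgue_on V)"
    "\<rho> \<in> borel_measurable (lebesgue_on V)" "\<And>x. x \<in> V \<Longrightarrow> \<phi> x < \<infinity>" "\<And>x. x \<in> V \<Longrightarrow> \<rho> x < \<infinity>"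
    using meas_below_top_near_common[OF assms] by blast
  show ?thesis
  proof (rule convexI)
    fix p q and u v :: real
    assume p: "p \<in> integrable_exponents a \<phi> \<rho>" and q: "q \<in> integrable_exponents a \<phi> \<rho>"
      and uv: "0 \<le> u" "0 \<le> v" "u + v = 1"
    obtain c s where cs: "p = (c, s)" "0 \<le> c" "0 \<le> s" "weighted_exp \<phi> \<rho> c s \<in> L1_loc a"
      using p by (auto simp: integrable_exponents_def)
    obtain d t where dt: "q = (d, t)" "0 \<le> d" "0 \<le> t" "weighted_exp \<phi> \<rho> d t \<in> L1_loc a"
      using q by (auto simp: integrable_exponents_def)
    have "weighted_exp \<phi> \<rho> (u * c + v * d) (u * s + v * t) \<in> L1_loc a"
      by (rule L1_loc_dominated[OF cs(4) dt(4) V(1,2) weighted_exp_measurable[OF V(3,4)]])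
        (use V(5,6) cs dt uv in \<open>auto intro!: weighted_exp_convex\<close>)
    then show "u *\<^sub>R p + v *\<^sub>R q \<in> integrable_exponents a \<phi> \<rho>"
      using cs dt uv by (simp add: integrable_exponents_def)
  qed
qed

lemma integrable_exponents_combination:
  assumes "convex (integrable_exponents a \<phi> \<rho>)"
    and "(c, s) \<in> integrable_exponents a \<phi> \<rho>" "(d, t) \<in> integrable_exponents a \<phi> \<rho>"
    and "0 \<le> u" "0 \<le> v" "u + v = 1"
  shows "(u * c + v * d, u * s + v * t) \<in> integrable_exponents a \<phi> \<rho>"
proof -
  have "u *\<^sub>R (c, s) + v *\<^sub>R (d, t) \<in> integrable_exponents a \<phi> \<rho>"
    by (rule convexD[OF assms])
  then show ?thesis by simp
qed

lemma zero_mem_integrable_exponents: "(0, 0) \<in> integrable_exponents a \<phi> \<rho>"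
  using L1_loc_const[of "ereal_exp 0" a]
  by (simp add: integrable_exponents_def weighted_exp_def ereal_exp_def flip: zero_ereal_def)
    (simp add: zero_ereal_def)

section \<open>Admissible weights\<close>

text \<open>Admissibility in terms of the set \<open>K\<close> at the origin, with the first weight zero.\<close>

lemma mem_weight_set_iff:
  "t \<in> weight_set \<psi> \<longleftrightarrow>
     0 \<le> t \<and> (\<exists>\<tau>>0. (0, (1 + \<tau>) * t) \<in> integrable_exponents 0 (\<lambda>_. 0) \<psi>)"
proof -
  have "ereal (2 * (1 + \<tau>)) * (ereal t * x) = ereal (2 * ((1 + \<tau>) * t)) * x" for \<tau> x
    by (simp add: mult.assoc[symmetric])
  then show ?thesis
    by (auto simp: weight_set_def admissible_weight_def scale_weight_def integrable_exponents_def
      weighted_exp_def zero_ereal_def[symmetric])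
qed

lemma zero_mem_weight_set: "0 \<in> weight_set \<psi>"
  using zero_mem_integrable_exponents by (auto simp: mem_weight_set_iff intro!: exI[of _ 1])

lemma meas_below_top_near_const: "c < \<infinity> \<Longrightarrow> meas_below_top_near a (\<lambda>_. c)"
  by (auto simp: meas_below_top_near_def intro!: exI[of _ UNIV])

lemma meas_below_top_near_borel:
  assumes "f \<in> borel_measurable borel" "\<And>x. f x < \<infinity>"
  shows "meas_below_top_near a f"
  using assms borel_measurable_lebesgue_on[OF assms(1)]
  by (auto simp: meas_below_top_near_def intro!: exI[of _ UNIV])

lemma integrable_exponents_segment:
  assumes "convex (integrable_exponents a \<phi> \<rho>)"
    and "(0, t) \<in> integrable_exponents a \<phi> \<rho>" "0 \<le> s" "s \<le> t"
  shows "(0, s) \<in> integrable_exponents a \<phi> \<rho>"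
proof (cases "t = 0")
  case False
  then have t: "t > 0" using assms by simp
  have "((1 - s / t) * 0 + s / t * 0, (1 - s / t) * 0 + s / t * t) \<in> integrable_exponents a \<phi> \<rho>"
    by (rule integrable_exponents_combination[OF assms(1) zero_mem_integrable_exponents assms(2)])
      (use t assms in auto)
  then show ?thesis using t by simp
qed (use assms zero_mem_integrable_exponents in auto)

lemma weight_set_downward:
  fixes \<psi> :: "complex ^ 'n \<Rightarrow> ereal"
  assumes "\<psi> \<in> borel_measurable borel" "\<And>x. \<psi> x < \<infinity>"
    and t: "t \<in> weight_set \<psi>" and s: "0 \<le> s" "s \<le> t"
  shows "s \<in> weight_set \<psi>"
proof -
  obtain \<tau> where \<tau>: "\<tau> > 0" "(0, (1 + \<tau>) * t) \<in> integrable_exponents 0 (\<lambda>_. 0) \<psi>"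
    using t by (auto simp: mem_weight_set_iff)
  have "(0, (1 + \<tau>) * s) \<in> integrable_exponents 0 (\<lambda>_. 0) \<psi>"
    by (rule integrable_exponents_segment[OF convex_integrable_exponents \<tau>(2)])
      (use \<tau> s assms in \<open>auto intro: meas_below_top_near_borel meas_below_top_near_const\<close>)
  then show ?thesis using \<tau>(1) s by (auto simp: mem_weight_set_iff)
qed

lemma is_interval_weight_set:
  fixes \<psi> :: "complex ^ 'n \<Rightarrow> ereal"
  assumes "\<psi> \<in> borel_measurable borel" "\<And>x. \<psi> x < \<infinity>"
  shows "is_interval (weight_set \<psi>)"
  unfolding is_interval_1
proof (intro ballI allI impI)
  fix a b x assume "a \<in> weight_set \<psi>" "b \<in> weight_set \<psi>" "a \<le> x \<and> x \<le> b"
  moreover have "0 \<le> a" using \<open>a \<in> weight_set \<psi>\<close> by (simp add: weight_set_def)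
  ultimately show "x \<in> weight_set \<psi>" using weight_set_downward[OF assms] by auto
qed

lemma weight_set_integrable_exponents:
  fixes \<psi> :: "complex ^ 'n \<Rightarrow> ereal"
  assumes [measurable]: "\<psi> \<in> borel_measurable borel" and \<psi>: "\<And>x. \<psi> x < \<infinity>"
    and t: "t \<in> weight_set \<psi>"
  shows "(0, t) \<in> integrable_exponents z \<phi> (\<lambda>x. \<psi> (x - z))"
proof -
  obtain \<tau> where \<tau>: "\<tau> > 0" "(0, (1 + \<tau>) * t) \<in> integrable_exponents 0 (\<lambda>_. 0) \<psi>" and t0: "0 \<le> t"
    using t by (auto simp: mem_weight_set_iff)
  have "(0, t) \<in> integrable_exponents 0 (\<lambda>_. 0) \<psi>"
    by (rule integrable_exponents_segment[OF convex_integrable_exponents \<tau>(2)])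
      (use \<tau> t0 assms in \<open>auto intro: meas_below_top_near_borel meas_below_top_near_const
         simp: algebra_simps\<close>)
  then have "weighted_exp (\<lambda>_. 0) \<psi> 0 t \<in> L1_loc 0"
    by (simp add: integrable_exponents_def)
  then have "(\<lambda>x. weighted_exp (\<lambda>_. 0) \<psi> 0 t (x - z)) \<in> L1_loc z"
    by (rule L1_loc_translate) (auto intro: weighted_exp_measurable)
  then show ?thesis using t0
    by (simp add: integrable_exponents_def weighted_exp_def zero_ereal_def[symmetric])
qed

section \<open>Lelong numbers and integrable exponents\<close>

lemma lelong_number_eq_Inf:
  "lelong_number z (scale_weight t \<psi>) \<phi> =
     Inf {ereal s | s. 0 < s \<and> weighted_exp \<phi> (\<lambda>x. \<psi> (x - z)) (1 / s) t \<in> L1_loc z}"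
proof -
  have *: "2 * x / ereal s = ereal (2 * (1 / s)) * x" if "0 < s" for x s
    using that by (cases x) auto
  have **: "2 * (ereal t * x) = ereal (2 * t) * x" for x
    by (cases x) (auto simp: zero_less_mult_iff)
  show ?thesis
    unfolding lelong_number_def weighted_exp_def scale_weight_def
    by (simp only: * ** cong: conj_cong)
qed

lemma lelong_number_nonneg: "0 \<le> lelong_number z \<rho> \<phi>"
  unfolding lelong_number_def by (intro Inf_greatest) auto

lemma lelong_number_le:
  assumes "(c, t) \<in> integrable_exponents z \<phi> (\<lambda>x. \<psi> (x - z))" "0 < c"
  shows "lelong_number z (scale_weight t \<psi>) \<phi> \<le> ereal (1 / c)"
  unfolding lelong_number_eq_Inf using assms
  by (intro Inf_lower) (auto simp: integrable_exponents_def intro!: exI[of _ "1 / c"])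

lemma inverse_lelong_number:
  assumes "0 \<le> t" "(0, t) \<in> integrable_exponents z \<phi> (\<lambda>x. \<psi> (x - z))"
  shows "1 / lelong_number z (scale_weight t \<psi>) \<phi> =
    Sup {ereal c | c. (c, t) \<in> integrable_exponents z \<phi> (\<lambda>x. \<psi> (x - z))}"
    (is "1 / ?\<nu> = Sup ?A")
proof (rule antisym)
  have nn: "0 \<le> ?\<nu>" by (rule lelong_number_nonneg)
  show "Sup ?A \<le> 1 / ?\<nu>"
  proof (rule Sup_least)
    fix y assume "y \<in> ?A"
    then obtain c where c: "y = ereal c" "(c, t) \<in> integrable_exponents z \<phi> (\<lambda>x. \<psi> (x - z))" by blast
    then have "0 \<le> c" by (simp add: integrable_exponents_def)
    show "y \<le> 1 / ?\<nu>"
    proof (cases "c = 0")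
      case True then show ?thesis using c nn by (cases ?\<nu>) (auto simp: one_ereal_def)
    next
      case False
      then have "0 < c" using \<open>0 \<le> c\<close> by simp
      then show ?thesis using lelong_number_le[OF c(2)] c(1) nn
        by (cases ?\<nu>) (auto simp: one_ereal_def field_simps)
    qed
  qed
  show "1 / ?\<nu> \<le> Sup ?A"
  proof (rule ccontr)
    assume "\<not> 1 / ?\<nu> \<le> Sup ?A"
    then obtain c where c: "Sup ?A < ereal c" "ereal c < 1 / ?\<nu>"
      using ereal_dense2 by (auto simp: not_le)
    have "0 \<le> Sup ?A" using assms(2) by (intro Sup_upper CollectI exI[of _ 0]) (simp add: zero_ereal_def)
    then have "0 < ereal c" using c(1) by (rule le_less_trans)
    then have c0: "0 < c" by simp
    have "?\<nu> < ereal (1 / c)"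
    proof (cases ?\<nu>)
      case (real v)
      show ?thesis
      proof (cases "v = 0")
        case True
        then show ?thesis using real c0 by simp
      next
        case False
        then have "0 < v" using nn real by simp
        moreover have "c < 1 / v" using c(2) real False by (simp add: one_ereal_def)
        ultimately show ?thesis using real c0 by (simp add: less_divide_eq mult.commute)
      qed
    qed (use c c0 nn in auto)
    then obtain y where "y < ereal (1 / c)"
        "y \<in> {ereal s | s. 0 < s \<and> weighted_exp \<phi> (\<lambda>x. \<psi> (x - z)) (1 / s) t \<in> L1_loc z}"
      unfolding lelong_number_eq_Inf Inf_less_iff by (elim bexE)
    then obtain s where "ereal s < ereal (1 / c)" and s: "0 < s"
        "weighted_exp \<phi> (\<lambda>x. \<psi> (x - z)) (1 / s) t \<in> L1_loc z"
      by (elim CollectE exE conjE) simp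
    then have sc: "s < 1 / c" by simp
    then have "ereal (1 / s) \<le> Sup ?A"
      using assms(1) s by (intro Sup_upper) (auto simp: integrable_exponents_def)
    also have "\<dots> < ereal c" by (rule c(1))
    finally show False using s sc c0 by (simp add: field_simps)
  qed
qed

text \<open>The next two lemmas carry the supremum of a convex combination, and the comparison of the
  harmonic and arithmetic means, over to values in \<open>[0, \<infinity>]\<close>.\<close>

lemma ereal_Sup_combination_le:
  fixes A B :: "ereal set" and u v :: real
  assumes "A \<noteq> {}" "B \<noteq> {}" "0 \<le> u" "0 \<le> v"
    and A: "\<And>a. a \<in> A \<Longrightarrow> 0 \<le> a" and B: "\<And>b. b \<in> B \<Longrightarrow> 0 \<le> b"
    and le: "\<And>a b. a \<in> A \<Longrightarrow> b \<in> B \<Longrightarrow> ereal u * a + ereal v * b \<le> C"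
  shows "ereal u * Sup A + ereal v * Sup B \<le> C"
proof -
  have nn: "0 \<le> ereal v * Sup B"
    using assms by (metis Sup_upper all_not_in_conv ereal_0_le_mult ereal_less_eq(5) order_trans)
  have nm: "ereal v * Sup B \<noteq> -\<infinity>" using nn by auto
  have "ereal u * Sup A + ereal v * Sup B = (SUP a\<in>A. ereal u * a + ereal v * Sup B)"
    using assms(1,3) A nm by (simp add: SUP_ereal_add_left SUP_ereal_mult_left)
  also have "\<dots> \<le> C"
  proof (rule SUP_least)
    fix a assume a: "a \<in> A"
    have "0 \<le> ereal u * a" using A[OF a] assms(3) by simp
    then have am: "ereal u * a \<noteq> -\<infinity>" by auto
    have "ereal u * a + ereal v * Sup B = (SUP b\<in>B. ereal u * a + ereal v * b)"
      using assms(2,4) B am by (simp add: SUP_ereal_add_right SUP_ereal_mult_left)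
    also have "\<dots> \<le> C" using le[OF a] by (rule SUP_least)
    finally show "ereal u * a + ereal v * Sup B \<le> C" .
  qed
  finally show ?thesis .
qed

lemma harmonic_le_arithmetic_ereal:
  fixes p q r :: ereal and u v :: real
  assumes nn: "0 \<le> p" "0 \<le> q" "0 \<le> r" and uv: "0 < u" "0 < v" "u + v = 1"
    and le: "ereal u * (1 / p) + ereal v * (1 / q) \<le> 1 / r"
  shows "r \<le> ereal u * p + ereal v * q"
proof (cases "p = \<infinity> \<or> q = \<infinity> \<or> r = 0")
  case True
  then show ?thesis using nn uv by auto
next
  case False
  then have r: "0 < r" and fin: "p < \<infinity>" "q < \<infinity>" using nn by auto
  have r1: "1 / r < \<infinity>" using r by (cases r) (auto simp: one_ereal_def)
  have p: "0 < p"
  proof (rule ccontr)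
    assume "\<not> 0 < p"
    then have "p = 0" using nn by auto
    then show False using le r1 nn uv by (cases q) (auto simp: divide_ereal_def split: if_splits)
  qed
  have q: "0 < q"
  proof (rule ccontr)
    assume "\<not> 0 < q"
    then have "q = 0" using nn by auto
    then show False using le r1 nn uv by (cases p) (auto simp: divide_ereal_def split: if_splits)
  qed
  obtain a where a: "p = ereal a" "0 < a" using p fin by (cases p) auto
  obtain b where b: "q = ereal b" "0 < b" using q fin by (cases q) auto
  have pos: "0 < u / a + v / b" using a b uv by (intro add_pos_pos divide_pos_pos)
  have "r \<noteq> \<infinity>" using le pos a b by (auto simp: one_ereal_def)
  then obtain c where c: "r = ereal c" "0 < c" using r by (cases r) auto
  have le': "u / a + v / b \<le> 1 / c" using le a b c by (simp add: one_ereal_def)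
  have "c = c * (u + v)\<^sup>2" using uv by simp
  also have "\<dots> \<le> c * ((u / a + v / b) * (u * a + v * b))"
  proof (rule mult_left_mono)
    have "(u / a + v / b) * (u * a + v * b) - (u + v)\<^sup>2 = u * v * (a - b)\<^sup>2 / (a * b)"
      using a b by (simp add: field_simps power2_eq_square)
    moreover have "0 \<le> u * v * (a - b)\<^sup>2 / (a * b)" using a b uv by simp
    ultimately show "(u + v)\<^sup>2 \<le> (u / a + v / b) * (u * a + v * b)" by linarith
  qed (use c in simp)
  also have "\<dots> = (c * (u / a + v / b)) * (u * a + v * b)" by simp
  also have "\<dots> \<le> 1 * (u * a + v * b)"
    using le' a b c uv by (intro mult_right_mono) (auto simp: field_simps)
  finally show ?thesis using a b c by simp
qed

section \<open>Concavity, convexity and monotonicity\<close>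

lemma ereal_concave_on_inverse_lelong_number:
  assumes conv: "convex (integrable_exponents z \<phi> (\<lambda>x. \<psi> (x - z)))"
    and T: "convex T" "\<And>t. t \<in> T \<Longrightarrow> (0, t) \<in> integrable_exponents z \<phi> (\<lambda>x. \<psi> (x - z))"
  shows "ereal_concave_on T (\<lambda>t. 1 / lelong_number z (scale_weight t \<psi>) \<phi>)"
  unfolding ereal_concave_on_def
proof (intro conjI ballI allI impI T(1))
  let ?K = "integrable_exponents z \<phi> (\<lambda>x. \<psi> (x - z))"
  have inv: "1 / lelong_number z (scale_weight t \<psi>) \<phi> = Sup {ereal c | c. (c, t) \<in> ?K}" if "t \<in> T" for t
    using inverse_lelong_number[OF _ T(2)[OF that]] T(2)[OF that] by (simp add: integrable_exponents_def)
  fix x y u v :: real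
  assume x: "x \<in> T" and y: "y \<in> T" and uv: "0 \<le> u" "0 \<le> v" "u + v = 1"
  have xy: "u *\<^sub>R x + v *\<^sub>R y \<in> T" using convexD[OF T(1) x y uv] .
  show "ereal u * (1 / lelong_number z (scale_weight x \<psi>) \<phi>)
      + ereal v * (1 / lelong_number z (scale_weight y \<psi>) \<phi>)
    \<le> 1 / lelong_number z (scale_weight (u *\<^sub>R x + v *\<^sub>R y) \<psi>) \<phi>"
    unfolding inv[OF x] inv[OF y] inv[OF xy]
  proof (rule ereal_Sup_combination_le)
    fix a b assume "a \<in> {ereal c |c. (c, x) \<in> ?K}" "b \<in> {ereal c |c. (c, y) \<in> ?K}"
    then obtain c d where cd: "a = ereal c" "b = ereal d" "(c, x) \<in> ?K" "(d, y) \<in> ?K" by blast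
    have "(u * c + v * d, u * x + v * y) \<in> ?K"
      by (rule integrable_exponents_combination[OF conv cd(3,4) uv])
    then show "ereal u * a + ereal v * b \<le> Sup {ereal c |c. (c, u *\<^sub>R x + v *\<^sub>R y) \<in> ?K}"
      using cd(1,2) by (intro Sup_upper) auto
  qed (use uv T(2)[OF x] T(2)[OF y] in \<open>auto simp: integrable_exponents_def\<close>)
qed

lemma ereal_convex_on_if_concave_inverse:
  assumes conc: "ereal_concave_on T (\<lambda>t. 1 / f t)" and nn: "\<And>t. t \<in> T \<Longrightarrow> 0 \<le> f t"
  shows "ereal_convex_on T f"
  unfolding ereal_convex_on_def
proof (intro conjI ballI allI impI)
  show T: "convex T" using conc by (simp add: ereal_concave_on_def)
  fix x y and u v :: real
  assume x: "x \<in> T" and y: "y \<in> T" and uv: "0 \<le> u" "0 \<le> v" "u + v = 1"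
  have conc_xy: "ereal u * (1 / f x) + ereal v * (1 / f y) \<le> 1 / f (u *\<^sub>R x + v *\<^sub>R y)"
    using conc x y uv by (auto simp: ereal_concave_on_def)
  have nn_xy: "0 \<le> f (u *\<^sub>R x + v *\<^sub>R y)" using nn convexD[OF T x y uv] .
  consider "u = 0" "v = 1" | "u = 1" "v = 0" | "0 < u" "0 < v" using uv by linarith
  then show "f (u *\<^sub>R x + v *\<^sub>R y) \<le> ereal u * f x + ereal v * f y"
  proof cases
    case 3
    then show ?thesis
      using harmonic_le_arithmetic_ereal[OF nn[OF x] nn[OF y] nn_xy _ _ uv(3) conc_xy] by simp
  qed (simp_all flip: one_ereal_def zero_ereal_def)
qed

text \<open>The point \<open>(0, N)\<close> may lie outside \<open>K\<close>; it is only approached by the points \<open>(0, m)\<close> of \<open>K\<close>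
  with \<open>m < N\<close>.\<close>

lemma lelong_number_antimono:
  assumes conv: "convex (integrable_exponents z \<phi> (\<lambda>x. \<psi> (x - z)))"
    and T: "\<And>t. 0 \<le> t \<Longrightarrow> t < N \<Longrightarrow> (0, t) \<in> integrable_exponents z \<phi> (\<lambda>x. \<psi> (x - z))"
  shows "antimono_on {0..<N} (\<lambda>t. ereal (N - t) * lelong_number z (scale_weight t \<psi>) \<phi>)"
proof (rule monotone_onI)
  let ?K = "integrable_exponents z \<phi> (\<lambda>x. \<psi> (x - z))"
  let ?\<nu> = "\<lambda>t. lelong_number z (scale_weight t \<psi>) \<phi>"
  fix t t' assume "t \<in> {0..<N}" "t' \<in> {0..<N}" "t \<le> t'"
  then have t: "0 \<le> t" "t \<le> t'" "t' < N" by auto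
  have key: "?\<nu> t' * ereal ((N - t') / (N - t)) \<le> ereal s"
    if s: "0 < s" "weighted_exp \<phi> (\<lambda>x. \<psi> (x - z)) (1 / s) t \<in> L1_loc z" for s
  proof -
    have K: "(1 / s, t) \<in> ?K" using s t by (simp add: integrable_exponents_def)
    have bound: "?\<nu> t' \<le> ereal (s * (m - t) / (m - t'))" if m: "t' < m" "m < N" for m
    proof -
      \<comment> \<open>the parameter at which the segment from \<open>(1 / s, t)\<close> to \<open>(0, m)\<close> lies over \<open>t'\<close>\<close>
      let ?v = "(t' - t) / (m - t)"
      have "((1 - ?v) * (1 / s) + ?v * 0, (1 - ?v) * t + ?v * m) \<in> ?K"
        by (rule integrable_exponents_combination[OF conv K T]) (use t m in auto)
      moreover have "(1 - ?v) * t + ?v * m = t'"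
      proof -
        have "(1 - v) * t + v * m = t + v * (m - t)" for v by (simp add: algebra_simps)
        then have "(1 - ?v) * t + ?v * m = t + ?v * (m - t)" .
        also have "\<dots> = t'" using m t by simp
        finally show ?thesis .
      qed
      moreover have "1 - ?v = (m - t') / (m - t)" using m t by (simp add: field_simps)
      ultimately have "((m - t') / ((m - t) * s), t') \<in> ?K" by simp
      from lelong_number_le[OF this] show ?thesis using m t s by (simp add: mult.commute)
    qed
    have "?\<nu> t' < \<infinity>" using bound[of "(t' + N) / 2"] t by (auto intro: le_less_trans)
    then obtain r where r: "?\<nu> t' = ereal r" using lelong_number_nonneg[of z "scale_weight t' \<psi>" \<phi>]
      by (cases "?\<nu> t'") auto
    have "r * (N - t') \<le> s * (N - t)"
    proof (rule tendsto_le[of "at_left N"])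
      show "((\<lambda>m. s * (m - t)) \<longlongrightarrow> s * (N - t)) (at_left N)" by (intro tendsto_intros)
      show "((\<lambda>m. r * (m - t')) \<longlongrightarrow> r * (N - t')) (at_left N)" by (intro tendsto_intros)
      show "eventually (\<lambda>m. r * (m - t') \<le> s * (m - t)) (at_left N)"
        using eventually_at_left_real[OF t(3)]
      proof eventually_elim
        case (elim m)
        then show ?case using bound[of m] r by (simp add: field_simps)
      qed
    qed simp
    then show ?thesis using r t by (simp add: field_simps)
  qed
  have "?\<nu> t' * ereal ((N - t') / (N - t)) \<le> ?\<nu> t"
    unfolding lelong_number_eq_Inf[of z t] by (rule Inf_greatest) (use key in blast)
  then have "ereal (N - t) * (?\<nu> t' * ereal ((N - t') / (N - t))) \<le> ereal (N - t) * ?\<nu> t"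
    using t by (intro ereal_mult_left_mono) auto
  moreover have "ereal (N - t) * (?\<nu> t' * ereal ((N - t') / (N - t))) = ereal (N - t') * ?\<nu> t'"
    using t lelong_number_nonneg[of z "scale_weight t' \<psi>" \<phi>] by (cases "?\<nu> t'") auto
  ultimately show "ereal (N - t') * ?\<nu> t' \<le> ereal (N - t) * ?\<nu> t" by simp
qed

section \<open>The logarithmic weight\<close>

lemma log_norm_measurable [measurable]: "log_norm \<in> borel_measurable borel"
  unfolding log_norm_def by measurable

lemma log_norm_neq_top: "log_norm x \<noteq> \<infinity>"
  by (simp add: log_norm_def)

text \<open>The unit ball without its centre is the union of the dyadic shells \<open>2\<^sup>-\<^sup>k\<^sup>-\<^sup>1 \<le> |x| < 2\<^sup>-\<^sup>k\<close>.  On the \<open>k\<close>-th shell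
  the integrand is at most \<open>2\<^sup>p\<^sup>(\<^sup>k\<^sup>+\<^sup>1\<^sup>)\<close>, and the volume is at most a constant times \<open>2\<^sup>-\<^sup>k\<^sup>D\<close>, where
  \<open>D\<close> is the dimension; the sum over \<open>k\<close> is geometric with ratio \<open>2\<^sup>p\<^sup>-\<^sup>D < 1\<close>.\<close>

lemma norm_powr_neg_L1_loc:
  fixes p :: real
  assumes p: "0 \<le> p" "p < DIM('a)"
  shows "(\<lambda>x::'a::euclidean_space. ennreal (norm x powr (- p))) \<in> L1_loc 0"
proof -
  let ?f = "\<lambda>x::'a. ennreal (norm x powr (- p))"
  let ?B = "\<lambda>k. ball (0::'a) ((1/2) ^ k)"
  let ?V = "unit_ball_vol (real DIM('a))"
  let ?q = "2 powr (p - DIM('a))"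
  define g :: "nat \<Rightarrow> 'a \<Rightarrow> ennreal"
    where "g = (\<lambda>k x. ennreal (2 powr (p * (real k + 1))) * indicator (?B k) x)"
  have g_meas: "g k \<in> borel_measurable lborel" for k
    unfolding g_def by (intro borel_measurable_times_ennreal borel_measurable_const borel_measurable_indicator) simp
  have pw: "?f x * indicator (ball 0 1) x \<le> (\<Sum>k. g k x)" for x
  proof (cases "x = 0 \<or> norm x \<ge> 1")
    \<comment> \<open>at the origin the left side vanishes, since \<open>0 powr a = 0\<close>\<close>
    case True then show ?thesis by auto
  next
    case False
    then have x: "0 < norm x" "norm x < 1" by auto
    obtain k where k: "(1/2) ^ Suc k \<le> norm x" "norm x < (1/2) ^ k"
    proof -
      define m where "m = (LEAST m. (1/2::real) ^ m \<le> norm x)"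
      obtain m0 where "(1/2::real) ^ m0 < norm x" using real_arch_pow_inv[OF x(1), of "1/2"] by auto
      then have m: "(1/2::real) ^ m \<le> norm x"
        unfolding m_def by (intro LeastI[of "\<lambda>m. (1/2::real) ^ m \<le> norm x" m0]) simp
      have "m \<noteq> 0" using m x by (intro notI) simp
      then obtain k where mk: "m = Suc k" by (cases m) auto
      have "\<not> (1/2::real) ^ k \<le> norm x"
        using not_less_Least[of k "\<lambda>m. (1/2::real) ^ m \<le> norm x"] mk by (simp add: m_def)
      then show thesis using that m mk by auto
    qed
    have half: "(1/2::real) ^ Suc k = 2 powr (- (real k + 1))"
      unfolding powr_minus_divide
      using powr_realpow[of 2 "Suc k"] by (simp add: power_one_over add.commute del: power_Suc)
    have "norm x powr (- p) \<le> ((1/2) ^ Suc k) powr (- p)"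
      using k p by (intro powr_mono2') auto
    also have "\<dots> = 2 powr (p * (real k + 1))" unfolding half by (simp add: powr_powr algebra_simps)
    finally have "?f x * indicator (ball 0 1) x \<le> g k x"
      using x k by (auto simp: g_def ennreal_leI)
    also have "\<dots> \<le> (\<Sum>k. g k x)"
      using sum_le_suminf[of "\<lambda>k. g k x" "{k}"] by simp
    finally show ?thesis .
  qed
  have shell: "2 powr (p * (real k + 1)) * (?V * ((1/2) ^ k) ^ DIM('a)) = 2 powr p * ?V * ?q ^ k" for k
  proof -
    have "((1/2::real) ^ k) ^ DIM('a) = 2 powr (- (real k * DIM('a)))"
      by (simp add: powr_minus powr_realpow power_one_over field_simps flip: power_mult of_nat_mult)
    moreover have "?q ^ k = 2 powr (real k * p) * 2 powr (- (real k * DIM('a)))"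
      by (simp add: powr_power algebra_simps flip: powr_add)
    ultimately show ?thesis by (simp add: powr_add algebra_simps)
  qed
  have "?q < 1" using p powr_less_one[of 2] by (simp add: powr_less_one)
  then have summ: "summable (\<lambda>k. 2 powr p * ?V * ?q ^ k)"
    by (intro summable_mult summable_geometric) simp
  have "(\<integral>\<^sup>+ x. ?f x \<partial>lebesgue_on (ball 0 1)) = (\<integral>\<^sup>+ x. ?f x * indicator (ball 0 1) x \<partial>lborel)"
    by (simp add: nn_integral_restrict_space nn_integral_completion)
  also have "\<dots> \<le> (\<integral>\<^sup>+ x. (\<Sum>k. g k x) \<partial>lborel)"
    by (intro nn_integral_mono pw)
  also have "\<dots> = (\<Sum>k. \<integral>\<^sup>+ x. g k x \<partial>lborel)"
    by (rule nn_integral_suminf) (rule g_meas)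
  also have "\<dots> = (\<Sum>k. ennreal (2 powr p * ?V * ?q ^ k))"
  proof (rule suminf_cong)
    fix k
    have "(\<integral>\<^sup>+ x. g k x \<partial>lborel)
        = ennreal (2 powr (p * (real k + 1))) * ennreal (?V * ((1/2) ^ k) ^ DIM('a))"
      unfolding g_def by (subst nn_integral_cmult_indicator) (auto simp: emeasure_ball)
    also have "\<dots> = ennreal (2 powr (p * (real k + 1)) * (?V * ((1/2) ^ k) ^ DIM('a)))"
      by (rule ennreal_mult'[symmetric]) simp
    finally show "(\<integral>\<^sup>+ x. g k x \<partial>lborel)
        = ennreal (2 powr p * ?V * ?q ^ k)" unfolding shell .
  qed
  also have "\<dots> < \<infinity>"
    unfolding infinity_ennreal_def less_top[symmetric]
    by (rule ennreal_suminf_neq_top[OF summ]) (intro mult_nonneg_nonneg zero_le_power; simp)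
  finally have "(\<integral>\<^sup>+ x. ?f x \<partial>lebesgue_on (ball 0 1)) < \<infinity>" .
  moreover have "?f \<in> borel_measurable (lebesgue_on (ball 0 1))"
    by (rule borel_measurable_lebesgue_on) measurable
  ultimately show ?thesis
    unfolding L1_loc_def by (auto intro!: exI[of _ "ball 0 1"])
qed

lemma log_norm_weight_set:
  assumes "0 \<le> t" "t < real CARD('n)"
  shows "t \<in> weight_set (log_norm :: complex ^ 'n \<Rightarrow> ereal)"
proof (cases "t = 0")
  case True
  then show ?thesis by (simp add: zero_mem_weight_set)
next
  case False
  let ?N = "real CARD('n)"
  \<comment> \<open>\<open>(1 + \<tau>) t < N\<close>, because \<open>\<tau> t < \<tau> N = N - t\<close>\<close>
  define \<tau> where "\<tau> = (?N - t) / ?N"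
  have t: "0 < t" "t < ?N" using assms False by auto
  have "\<tau> > 0" using t by (simp add: \<tau>_def)
  define p where "p = (1 + \<tau>) * t"
  have "\<tau> * t < \<tau> * ?N" using \<open>\<tau> > 0\<close> t by simp
  moreover have "\<tau> * ?N = ?N - t" using t by (simp add: \<tau>_def)
  ultimately have p: "0 < p" "p < ?N"
    using \<open>\<tau> > 0\<close> t by (auto simp: p_def algebra_simps intro: add_pos_pos)
  have f: "(\<lambda>x::complex ^ 'n. ennreal (norm x powr (- (2 * p)))) \<in> L1_loc 0"
    by (rule norm_powr_neg_L1_loc) (use p in auto)
  obtain U :: "(complex ^ 'n) set" where U: "open U" "0 \<in> U"
      "(\<integral>\<^sup>+ x. ennreal (norm x powr (- (2 * p))) \<partial>lebesgue_on U) < \<infinity>"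
    using f by (auto simp: L1_loc_def)
  have eq: "weighted_exp (\<lambda>_. 0) log_norm 0 p x = ennreal (norm x powr (- (2 * p)))" if "x \<noteq> 0" for x :: "complex ^ 'n"
    using that by (simp add: weighted_exp_def log_norm_def ereal_exp_def powr_def)
  have "(\<integral>\<^sup>+ x. weighted_exp (\<lambda>_. 0) log_norm 0 p x \<partial>lebesgue_on U)
      = (\<integral>\<^sup>+ x. weighted_exp (\<lambda>_. 0) log_norm 0 p x * indicator U x \<partial>lborel)"
    using U by (simp add: nn_integral_restrict_space nn_integral_completion)
  also have "\<dots> = (\<integral>\<^sup>+ x. ennreal (norm x powr (- (2 * p))) * indicator U x \<partial>lborel)"
    \<comment> \<open>at the origin the two integrands are \<open>\<infinity>\<close> and \<open>0\<close>\<close>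
    using AE_lborel_singleton[of "0 :: complex ^ 'n"] by (intro nn_integral_cong_AE) (auto simp: eq)
  also have "\<dots> = (\<integral>\<^sup>+ x. ennreal (norm x powr (- (2 * p))) \<partial>lebesgue_on U)"
    using U by (simp add: nn_integral_restrict_space nn_integral_completion)
  finally have "(\<integral>\<^sup>+ x. weighted_exp (\<lambda>_. 0) log_norm 0 p x \<partial>lebesgue_on U) < \<infinity>" using U(3) by simp
  moreover have "weighted_exp (\<lambda>_. 0) (log_norm :: complex ^ 'n \<Rightarrow> ereal) 0 p \<in> borel_measurable (lebesgue_on U)"
    by (intro borel_measurable_lebesgue_on weighted_exp_measurable) auto
  ultimately have "weighted_exp (\<lambda>_. 0) (log_norm :: complex ^ 'n \<Rightarrow> ereal) 0 p \<in> L1_loc 0"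
    using U by (auto simp: L1_loc_def)
  then show ?thesis using \<open>\<tau> > 0\<close> p t
    by (auto simp: mem_weight_set_iff integrable_exponents_def p_def)
qed

lemma lelong_number_log_zero_le:
  assumes "0 \<le> t" and "meas_below_top_near z \<phi>"
  shows "lelong_number_log z 0 \<phi> \<le> lelong_number_log z t \<phi>"
  unfolding lelong_number_log_def lelong_number_eq_Inf
proof (rule Inf_superset_mono, rule subsetI)
  fix y
  let ?\<rho> = "\<lambda>x. log_norm (x - z)"
  assume "y \<in> {ereal s | s. 0 < s \<and> weighted_exp \<phi> ?\<rho> (1 / s) t \<in> L1_loc z}"
  then obtain s where s: "y = ereal s" "0 < s" and int: "weighted_exp \<phi> ?\<rho> (1 / s) t \<in> L1_loc z"
    by blast
  have \<rho>: "meas_below_top_near z ?\<rho>"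
    by (rule meas_below_top_near_borel) (auto simp: log_norm_neq_top)
  obtain V where V: "open V" "z \<in> V" "\<phi> \<in> borel_measurable (lebesgue_on V)"
    "?\<rho> \<in> borel_measurable (lebesgue_on V)"
    by (rule meas_below_top_near_common[OF assms(2) \<rho>], rule that)
  have le: "weighted_exp \<phi> ?\<rho> (1 / s) 0 x \<le> weighted_exp \<phi> ?\<rho> (1 / s) t x + 0" if "x \<in> V \<inter> ball z 1" for x
  proof -
    have "norm (x - z) < 1" using that by (simp add: dist_norm norm_minus_commute)
    then have "log_norm (x - z) \<le> 0"
      unfolding log_norm_def by (cases "x = z") (simp_all add: ln_le_zero_iff)
    then have "ereal (2 * t) * log_norm (x - z) \<le> 0"
      using assms(1) by (cases "log_norm (x - z)") (auto simp: mult_le_0_iff)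
    then have "- (ereal (2 * (1 / s)) * \<phi> x) - 0
        \<le> - (ereal (2 * (1 / s)) * \<phi> x) - ereal (2 * t) * log_norm (x - z)"
      by (intro ereal_minus_mono) auto
    then show ?thesis by (simp add: weighted_exp_def ereal_exp_mono flip: zero_ereal_def)
  qed
  have "weighted_exp \<phi> ?\<rho> (1 / s) 0 \<in> borel_measurable (lebesgue_on (V \<inter> ball z 1))"
    using weighted_exp_measurable[OF V(3,4)] by (rule measurable_restrict_mono) auto
  then have "weighted_exp \<phi> ?\<rho> (1 / s) 0 \<in> L1_loc z"
    by (rule L1_loc_dominated[OF int L1_loc_const[of 0], rotated 3]) (use V le in auto)
  then show "y \<in> {ereal s | s. 0 < s \<and> weighted_exp \<phi> ?\<rho> (1 / s) 0 \<in> L1_loc z}"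
    using s by blast
qed

section \<open>Plurisubharmonic functions\<close>

lemma plurisubharmonic_on_meas_below_top_near:
  assumes "plurisubharmonic_on \<Omega> \<phi>" "z \<in> \<Omega>"
  shows "meas_below_top_near z \<phi>"
  unfolding meas_below_top_near_def
proof (intro exI conjI)
  have psh: "open \<Omega>" "usc_on \<Omega> \<phi>" "\<forall>x\<in>\<Omega>. \<phi> x < \<infinity>"
    using assms(1) unfolding plurisubharmonic_on_def by simp_all
  show "open \<Omega>" "\<forall>x\<in>\<Omega>. \<phi> x < \<infinity>" by (fact psh)+
  show "\<phi> \<in> borel_measurable (lebesgue_on \<Omega>)"
    by (intro borel_measurable_restrict_lebesgue_on usc_on_borel_measurable psh)
qed (fact assms(2))

theorem lemma2p2:
  fixes n :: nat and \<Omega> :: "(complex ^ 'n) set" and z :: "complex ^ 'n"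
    and \<phi> \<psi> :: "complex ^ 'n \<Rightarrow> ereal"
  assumes "n = CARD('n)"
    and "open \<Omega>" and "z \<in> \<Omega>"
    and "plurisubharmonic_on \<Omega> \<phi>" and "plurisubharmonic_on UNIV \<psi>"
  shows
    "0 \<in> weight_set \<psi> \<and> is_interval (weight_set \<psi>) \<and>
     (ereal_concave_on (weight_set \<psi>) (\<lambda>t. 1 / lelong_number z (scale_weight t \<psi>) \<phi>) \<and>
      ereal_convex_on (weight_set \<psi>) (\<lambda>t. lelong_number z (scale_weight t \<psi>) \<phi>)) \<and>
     ({0..<real n} \<subseteq> weight_set \<psi> \<and> (\<lambda>\<zeta>. ereal_exp (- (ereal (2 * real n) * \<psi> \<zeta>))) \<notin> L1_loc 0 \<longrightarrow>
      antimono_on {0..<real n} (\<lambda>t. ereal (real n - t) * lelong_number z (scale_weight t \<psi>) \<phi>)) \<and>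
     (\<forall>t. 0 \<le> t \<and> t \<le> real n - 1 \<longrightarrow>
        lelong_number_log z 0 \<phi> \<le> lelong_number_log z (real n - 1) \<phi> \<and>
        lelong_number_log z (real n - 1) \<phi> \<le> ereal (real n - t) * lelong_number_log z t \<phi> \<and>
        ereal (real n - t) * lelong_number_log z t \<phi> \<le> ereal (real n) * lelong_number_log z 0 \<phi>)"
proof -
  have \<phi>: "meas_below_top_near z \<phi>"
    using plurisubharmonic_on_meas_below_top_near assms by blast
  have \<psi>: "\<psi> \<in> borel_measurable borel" "\<And>x. \<psi> x < \<infinity>"
    using assms(5) usc_on_borel_measurable[of UNIV \<psi>] by (auto simp: plurisubharmonic_on_def)
  have conv: "convex (integrable_exponents z \<phi> (\<lambda>x. \<rho> (x - z)))"
    if [measurable]: "\<rho> \<in> borel_measurable borel" and "\<And>x. \<rho> x < \<infinity>" for \<rho>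
    using that by (intro convex_integrable_exponents \<phi> meas_below_top_near_borel) auto
  have interval: "is_interval (weight_set \<psi>)" using is_interval_weight_set[OF \<psi>] .
  have concave: "ereal_concave_on (weight_set \<psi>) (\<lambda>t. 1 / lelong_number z (scale_weight t \<psi>) \<phi>)"
    using interval conv[OF \<psi>] weight_set_integrable_exponents[OF \<psi>]
    by (intro ereal_concave_on_inverse_lelong_number) (auto simp: is_interval_convex)
  have antimono: "antimono_on {0..<real n} (\<lambda>t. ereal (real n - t) * lelong_number z (scale_weight t \<rho>) \<phi>)"
    if "\<rho> \<in> borel_measurable borel" "\<And>x. \<rho> x < \<infinity>" "{0..<real n} \<subseteq> weight_set \<rho>" for \<rho>
    by (rule lelong_number_antimono[OF conv[OF that(1,2)] weight_set_integrable_exponents[OF that(1,2)]])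
      (use that(3) in auto)
  have n1: "real n \<ge> 1" using assms(1) by (simp add: Suc_le_eq)
  have log: "antimono_on {0..<real n} (\<lambda>t. ereal (real n - t) * lelong_number_log z t \<phi>)"
    unfolding lelong_number_log_def
    by (rule antimono) (use assms(1) in \<open>auto simp: log_norm_neq_top intro: log_norm_weight_set\<close>)
  have chain: "lelong_number_log z 0 \<phi> \<le> lelong_number_log z (real n - 1) \<phi> \<and>
        lelong_number_log z (real n - 1) \<phi> \<le> ereal (real n - t) * lelong_number_log z t \<phi> \<and>
        ereal (real n - t) * lelong_number_log z t \<phi> \<le> ereal (real n) * lelong_number_log z 0 \<phi>"
    if t: "0 \<le> t" "t \<le> real n - 1" for t
  proof (intro conjI)
    show "lelong_number_log z 0 \<phi> \<le> lelong_number_log z (real n - 1) \<phi>"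
      using n1 by (intro lelong_number_log_zero_le \<phi>) simp
    have "ereal (real n - (real n - 1)) * lelong_number_log z (real n - 1) \<phi>
        \<le> ereal (real n - t) * lelong_number_log z t \<phi>"
      by (rule monotone_onD[OF log]) (use t in auto)
    moreover have "ereal (real n - (real n - 1)) = 1" by (simp add: one_ereal_def)
    ultimately show "lelong_number_log z (real n - 1) \<phi> \<le> ereal (real n - t) * lelong_number_log z t \<phi>"
      by (simp only: mult_1)
    have "ereal (real n - t) * lelong_number_log z t \<phi> \<le> ereal (real n - 0) * lelong_number_log z 0 \<phi>"
      by (rule monotone_onD[OF log]) (use t in auto)
    then show "ereal (real n - t) * lelong_number_log z t \<phi> \<le> ereal (real n) * lelong_number_log z 0 \<phi>"
      by (simp only: diff_zero)
  qed
  have convex: "ereal_convex_on (weight_set \<psi>) (\<lambda>t. lelong_number z (scale_weight t \<psi>) \<phi>)"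
    by (rule ereal_convex_on_if_concave_inverse[OF concave lelong_number_nonneg])
  show ?thesis
    by (intro conjI impI allI zero_mem_weight_set interval concave convex antimono[OF \<psi>])
      (use chain in auto)
qed

end
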